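(* Let $M \prec N$ be structures, both $\aleph_0$-saturated, and let $G$ be a group definable over $M$. Then the following are equivalent: (i) the definable (in $M$, with parameters) subsets of $G(M)$ that are J-sets of $G$ in $M$ are exactly those that are weakly generic in $G(M)$; (ii) the definable (in $N$, with parameters) subsets of $G(N)$ that are J-sets of $G$ in $N$ are exactly those that are weakly generic in $G(N)$.
   Context: Here $\mathbb{N}=\{1,2,\dots\}$. For $m\ge 1$ let $\mathfrak{j}_m=\{s\in\mathbb{N}^m : s(1)<s(2)<\dots<s(m)\}$. For a structure $M$, a group $G$ definable over $M$, $m\ge 1$, $a\in G(M)^{m+1}$, $t\in\mathfrak{j}_m$ and $f\in G(M)^{\mathbb{N}}$, put $\chi(m,a,t,f)=a(1)f(t(1))a(2)f(t(2))\cdots a(m)f(t(m))a(m+1)$. A subset $X\subset G(M)$ is a J-set of $G$ in $M$ if for every finite $F\subset G(M)^{\mathbb{N}}$ there are $m\ge 1$, $t\in\mathfrak{j}_m$ and $a\in G(M)^{m+1}$ such that $\chi(m,a,t,f)\in X$ for every $f\in F$. A subset $X\subset G(M)$ is generic if $G(M)$ is covered by finitely many left translates $gX$, $g\in G(M)$; $X$ is weakly generic if $X\cup Y$ is generic for some non-generic $Y\subset G(M)$. *)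

theory Defs
  imports "HOL-Algebra.Coset" "HOL-Library.FuncSet"
begin

section \<open>First-order structures\<close>

text \<open>The symbols of a language are given by subsets of the types \<open>'f\<close> and \<open>'r\<close>, so that either
  set may be empty. Constants are function symbols of arity 0; equality is a logical symbol.\<close>

record ('f, 'r) lang =
  fun_syms :: "'f set"
  rel_syms :: "'r set"
  fun_arity :: "'f \<Rightarrow> nat"
  rel_arity :: "'r \<Rightarrow> nat"

record ('a, 'f, 'r) struct =
  universe :: "'a set"
  fun_interp :: "'f \<Rightarrow> 'a list \<Rightarrow> 'a"
  rel_interp :: "'r \<Rightarrow> 'a list \<Rightarrow> bool"

definition tuples :: "'a set \<Rightarrow> nat \<Rightarrow> 'a list set" where
  "tuples A n = {xs. length xs = n \<and> set xs \<subseteq> A}"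

definition is_structure :: "('f, 'r) lang \<Rightarrow> ('a, 'f, 'r) struct \<Rightarrow> bool" where
  "is_structure L M \<longleftrightarrow> universe M \<noteq> {} \<and>
     (\<forall>f\<in>fun_syms L. \<forall>xs\<in>tuples (universe M) (fun_arity L f). fun_interp M f xs \<in> universe M)"

datatype 'f trm = Var nat | Fn 'f "'f trm list"

datatype ('f, 'r) fm =
    Eq "'f trm" "'f trm"
  | Rel 'r "'f trm list"
  | Neg "('f, 'r) fm"
  | Conj "('f, 'r) fm" "('f, 'r) fm"
  | Ex nat "('f, 'r) fm"

fun wf_trm :: "('f, 'r) lang \<Rightarrow> 'f trm \<Rightarrow> bool" where
  "wf_trm L (Var i) \<longleftrightarrow> True"
| "wf_trm L (Fn f ts) \<longleftrightarrow> f \<in> fun_syms L \<and> length ts = fun_arity L f \<and> (\<forall>t\<in>set ts. wf_trm L t)"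

fun wf_fm :: "('f, 'r) lang \<Rightarrow> ('f, 'r) fm \<Rightarrow> bool" where
  "wf_fm L (Eq s t) \<longleftrightarrow> wf_trm L s \<and> wf_trm L t"
| "wf_fm L (Rel r ts) \<longleftrightarrow> r \<in> rel_syms L \<and> length ts = rel_arity L r \<and> (\<forall>t\<in>set ts. wf_trm L t)"
| "wf_fm L (Neg p) \<longleftrightarrow> wf_fm L p"
| "wf_fm L (Conj p q) \<longleftrightarrow> wf_fm L p \<and> wf_fm L q"
| "wf_fm L (Ex i p) \<longleftrightarrow> wf_fm L p"

fun fv_trm :: "'f trm \<Rightarrow> nat set" where
  "fv_trm (Var i) = {i}"
| "fv_trm (Fn f ts) = (\<Union>t\<in>set ts. fv_trm t)"

fun fv :: "('f, 'r) fm \<Rightarrow> nat set" where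
  "fv (Eq s t) = fv_trm s \<union> fv_trm t"
| "fv (Rel r ts) = (\<Union>t\<in>set ts. fv_trm t)"
| "fv (Neg p) = fv p"
| "fv (Conj p q) = fv p \<union> fv q"
| "fv (Ex i p) = fv p - {i}"

fun trm_val :: "('a, 'f, 'r) struct \<Rightarrow> (nat \<Rightarrow> 'a) \<Rightarrow> 'f trm \<Rightarrow> 'a" where
  "trm_val M v (Var i) = v i"
| "trm_val M v (Fn f ts) = fun_interp M f (map (trm_val M v) ts)"

fun sat :: "('a, 'f, 'r) struct \<Rightarrow> (nat \<Rightarrow> 'a) \<Rightarrow> ('f, 'r) fm \<Rightarrow> bool" where
  "sat M v (Eq s t) \<longleftrightarrow> trm_val M v s = trm_val M v t"
| "sat M v (Rel r ts) \<longleftrightarrow> rel_interp M r (map (trm_val M v) ts)"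
| "sat M v (Neg p) \<longleftrightarrow> \<not> sat M v p"
| "sat M v (Conj p q) \<longleftrightarrow> sat M v p \<and> sat M v q"
| "sat M v (Ex i p) \<longleftrightarrow> (\<exists>a\<in>universe M. sat M (v(i := a)) p)"

definition substructure ::
    "('f, 'r) lang \<Rightarrow> ('a, 'f, 'r) struct \<Rightarrow> ('a, 'f, 'r) struct \<Rightarrow> bool" where
  "substructure L M N \<longleftrightarrow> is_structure L M \<and> is_structure L N \<and> universe M \<subseteq> universe N \<and>
     (\<forall>f\<in>fun_syms L. \<forall>xs\<in>tuples (universe M) (fun_arity L f).
        fun_interp M f xs = fun_interp N f xs) \<and>
     (\<forall>r\<in>rel_syms L. \<forall>xs\<in>tuples (universe M) (rel_arity L r).
        rel_interp M r xs \<longleftrightarrow> rel_interp N r xs)"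

definition elementary_substructure ::
    "('f, 'r) lang \<Rightarrow> ('a, 'f, 'r) struct \<Rightarrow> ('a, 'f, 'r) struct \<Rightarrow> bool" where
  "elementary_substructure L M N \<longleftrightarrow> substructure L M N \<and>
     (\<forall>p v. wf_fm L p \<longrightarrow> range v \<subseteq> universe M \<longrightarrow> (sat M v p \<longleftrightarrow> sat N v p))"

section \<open>Definable sets and saturation\<close>

text \<open>A formula with parameters in the free variables \<open>0, \<dots>, n - 1\<close> is a pair \<open>(p, c)\<close>; a free
  variable \<open>i \<ge> n\<close> of \<open>p\<close> stands for the parameter \<open>c i\<close>. Other values of \<open>c\<close> are irrelevant.\<close>

type_synonym ('a, 'f, 'r) pfm = "('f, 'r) fm \<times> (nat \<Rightarrow> 'a)"

definition pfms_over :: "('f, 'r) lang \<Rightarrow> 'a set \<Rightarrow> nat \<Rightarrow> ('a, 'f, 'r) pfm set" where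
  "pfms_over L A n = {(p, c). wf_fm L p \<and> (\<forall>i\<in>fv p. n \<le> i \<longrightarrow> c i \<in> A)}"

definition solutions :: "('a, 'f, 'r) struct \<Rightarrow> nat \<Rightarrow> ('a, 'f, 'r) pfm \<Rightarrow> 'a list set" where
  "solutions M n P =
     {xs \<in> tuples (universe M) n. sat M (\<lambda>i. if i < n then xs ! i else snd P i) (fst P)}"

definition definable :: "('f, 'r) lang \<Rightarrow> ('a, 'f, 'r) struct \<Rightarrow> nat \<Rightarrow> 'a list set \<Rightarrow> bool" where
  "definable L M n X \<longleftrightarrow> (\<exists>P\<in>pfms_over L (universe M) n. X = solutions M n P)"

definition aleph0_saturated :: "('f, 'r) lang \<Rightarrow> ('a, 'f, 'r) struct \<Rightarrow> bool" where
  "aleph0_saturated L M \<longleftrightarrow>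
     (\<forall>A \<Gamma>. finite A \<longrightarrow> A \<subseteq> universe M \<longrightarrow> \<Gamma> \<subseteq> pfms_over L A 1 \<longrightarrow>
        (\<forall>\<Delta>. finite \<Delta> \<longrightarrow> \<Delta> \<subseteq> \<Gamma> \<longrightarrow> (\<exists>b\<in>universe M. \<forall>P\<in>\<Delta>. [b] \<in> solutions M 1 P)) \<longrightarrow>
        (\<exists>b\<in>universe M. \<forall>P\<in>\<Gamma>. [b] \<in> solutions M 1 P))"

section \<open>Definable groups\<close>

text \<open>A formula for the underlying set (of \<open>gdim\<close>-tuples) and a formula for the graph of
  multiplication, in the variables \<open>x @ y @ z\<close> for \<open>x \<cdot> y = z\<close>.\<close>

record ('a, 'f, 'r) grp_fms =
  gdim :: nat
  gset :: "('a, 'f, 'r) pfm"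
  gmult :: "('a, 'f, 'r) pfm"

definition points :: "('a, 'f, 'r) grp_fms \<Rightarrow> ('a, 'f, 'r) struct \<Rightarrow> 'a list set" where
  "points G M = solutions M (gdim G) (gset G)"

definition grp_mult :: "('a, 'f, 'r) grp_fms \<Rightarrow> ('a, 'f, 'r) struct \<Rightarrow> 'a list \<Rightarrow> 'a list \<Rightarrow> 'a list"
  where "grp_mult G M x y =
    (THE z. z \<in> points G M \<and> x @ y @ z \<in> solutions M (3 * gdim G) (gmult G))"

definition group_of :: "('a, 'f, 'r) grp_fms \<Rightarrow> ('a, 'f, 'r) struct \<Rightarrow> 'a list monoid" where
  "group_of G M =
    \<lparr>carrier = points G M,
     mult = grp_mult G M,
     one = (THE e. e \<in> points G M \<and>
              (\<forall>x\<in>points G M. grp_mult G M e x = x \<and> grp_mult G M x e = x))\<rparr>"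

definition definable_group ::
    "('f, 'r) lang \<Rightarrow> ('a, 'f, 'r) struct \<Rightarrow> ('a, 'f, 'r) grp_fms \<Rightarrow> bool" where
  "definable_group L M G \<longleftrightarrow>
     gset G \<in> pfms_over L (universe M) (gdim G) \<and>
     gmult G \<in> pfms_over L (universe M) (3 * gdim G) \<and>
     (\<forall>x\<in>points G M. \<forall>y\<in>points G M.
        \<exists>!z. z \<in> points G M \<and> x @ y @ z \<in> solutions M (3 * gdim G) (gmult G)) \<and>
     group (group_of G M)"

section \<open>J-sets and weakly generic sets\<close>

text \<open>Sequences are indexed from 1; only the values of \<open>t\<close> on \<open>{1..m}\<close> and of \<open>a\<close> on \<open>{1..m+1}\<close>
  matter.\<close>

definition incr_seqs :: "nat \<Rightarrow> (nat \<Rightarrow> nat) set" where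
  "incr_seqs m = {s \<in> {1..m} \<rightarrow>\<^sub>E {1..}. strict_mono_on {1..m} s}"

text \<open>\<open>chi G m a t f = a(1) f(t(1)) a(2) \<dots> a(m) f(t(m)) a(m+1)\<close>; the case \<open>m = 0\<close> only serves to
  start the recursion.\<close>

fun chi :: "('g, 'b) monoid_scheme \<Rightarrow> nat \<Rightarrow> (nat \<Rightarrow> 'g) \<Rightarrow> (nat \<Rightarrow> nat) \<Rightarrow> (nat \<Rightarrow> 'g) \<Rightarrow> 'g" where
  "chi G 0 a t f = a 1"
| "chi G (Suc m) a t f = chi G m a t f \<otimes>\<^bsub>G\<^esub> f (t (Suc m)) \<otimes>\<^bsub>G\<^esub> a (Suc (Suc m))"

definition J_set :: "('g, 'b) monoid_scheme \<Rightarrow> 'g set \<Rightarrow> bool" where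
  "J_set G X \<longleftrightarrow> X \<subseteq> carrier G \<and>
     (\<forall>F. finite F \<longrightarrow> F \<subseteq> {1..} \<rightarrow>\<^sub>E carrier G \<longrightarrow>
        (\<exists>m\<ge>1. \<exists>t\<in>incr_seqs m. \<exists>a\<in>{1..m+1} \<rightarrow>\<^sub>E carrier G. \<forall>f\<in>F. chi G m a t f \<in> X))"

definition generic :: "('g, 'b) monoid_scheme \<Rightarrow> 'g set \<Rightarrow> bool" where
  "generic G X \<longleftrightarrow> X \<subseteq> carrier G \<and>
     (\<exists>S. finite S \<and> S \<subseteq> carrier G \<and> carrier G \<subseteq> (\<Union>g\<in>S. g <#\<^bsub>G\<^esub> X))"

definition weakly_generic :: "('g, 'b) monoid_scheme \<Rightarrow> 'g set \<Rightarrow> bool" where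
  "weakly_generic G X \<longleftrightarrow> X \<subseteq> carrier G \<and>
     (\<exists>Y \<subseteq> carrier G. \<not> generic G Y \<and> generic G (X \<union> Y))"

end

theory Submission
  imports Defs
begin

text \<open>Two elementarily equivalent \<open>\<aleph>\<^sub>0\<close>-saturated structures \<open>M\<close> and \<open>N\<close> are linked by a
  back-and-forth system, namely the finite partial elementary maps: such a map extends to one more
  point on either side, because saturation realises the type to be matched
  (\<open>fin_partial_elem_forth\<close>). When the parameters of the group lie in the domain and are fixed, the
  system lifts to tuples and links \<open>G(M)\<close> with \<open>G(N)\<close>, preserving multiplication. When it also
  matches the parameters \<open>c\<close> of a formula in \<open>M\<close> with the parameters \<open>c'\<close> of the same formula
  in \<open>N\<close>, it preserves membership in the sets \<open>X\<close> and \<open>Y\<close> that the formula defines.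

  Weak genericity and being a J-set are both invariant under such systems. Weak genericity amounts
  to a condition \<open>\<exists>S \<forall>K \<exists>x \<forall>h\<in>K \<exists>g\<in>S. g h x \<in> X\<close> with \<open>S\<close> and \<open>K\<close> ranging over finite sets of
  group elements (\<open>weakly_generic_iff\<close>), and such a condition can be played through the
  back-and-forth game. For J-sets, a finite set of sequences in \<open>G(N)\<close> is matched term by term along
  an increasing chain of maps, which gives sequences in \<open>G(M)\<close>. A product of the required kind that
  lies in \<open>X\<close> involves only finitely many of their terms, all in the domain of one map of the
  chain, and extending that map to the coefficients carries the product to \<open>Y\<close>
  (\<open>J_set_forth\<close>).

  Given a definable subset of \<open>G(N)\<close>, the back property finds in \<open>M\<close> parameters of the same type,
  hence a definable subset of \<open>G(M)\<close> with the same two properties. Thus coincidence of the two notions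
  passes from \<open>M\<close> to \<open>N\<close>; since the situation is symmetric up to reversing all maps, it
  also passes from \<open>N\<close> to \<open>M\<close>.\<close>

section \<open>Formulas\<close>

lemma trm_val_cong:
  "(\<And>i. i \<in> fv_trm t \<Longrightarrow> v i = w i) \<Longrightarrow> trm_val M v t = trm_val M w t"
proof (induction t)
  case (Fn f ts)
  then have "map (trm_val M v) ts = map (trm_val M w) ts" by auto
  then show ?case by (simp only: trm_val.simps)
qed simp

lemma sat_cong:
  "(\<And>i. i \<in> fv p \<Longrightarrow> v i = w i) \<Longrightarrow> sat M v p \<longleftrightarrow> sat M w p"
proof (induction p arbitrary: v w)
  case (Eq s t)
  then show ?case using trm_val_cong[of s v w M] trm_val_cong[of t v w M] by auto
next
  case (Rel r ts)
  then have "map (trm_val M v) ts = map (trm_val M w) ts" by (auto intro: trm_val_cong)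
  then show ?case by (simp only: sat.simps)
next
  case (Neg p)
  have "sat M v p \<longleftrightarrow> sat M w p" by (rule Neg.IH) (use Neg.prems in auto)
  then show ?case by simp
next
  case (Conj p q)
  have "sat M v p \<longleftrightarrow> sat M w p" by (rule Conj.IH(1)) (use Conj.prems in auto)
  moreover have "sat M v q \<longleftrightarrow> sat M w q" by (rule Conj.IH(2)) (use Conj.prems in auto)
  ultimately show ?case by simp
next
  case (Ex i p)
  have "sat M (v(i := a)) p = sat M (w(i := a)) p" for a
    by (rule Ex.IH) (use Ex.prems in auto)
  then show ?case by simp
qed

lemma finite_fv_trm: "finite (fv_trm t)"
  by (induction t) auto

lemma finite_fv: "finite (fv p)"
  by (induction p) (auto simp: finite_fv_trm)

lemma ex_finite_conj:
  assumes "finite \<Phi>" "k \<in> I" "\<And>p. p \<in> \<Phi> \<Longrightarrow> wf_fm L p \<and> fv p \<subseteq> I"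
  shows "\<exists>q. wf_fm L q \<and> fv q \<subseteq> I \<and>
    (\<forall>(M :: ('a, 'f, 'r) struct) v. sat M v q \<longleftrightarrow> (\<forall>p\<in>\<Phi>. sat M v p))"
  using assms(1,3)
proof (induction \<Phi>)
  case empty
  show ?case using assms(2) by (intro exI[of _ "Eq (Var k) (Var k)"]) auto
next
  case (insert p \<Phi>)
  then obtain q where "wf_fm L q" "fv q \<subseteq> I"
    "\<forall>(M :: ('a, 'f, 'r) struct) v. sat M v q \<longleftrightarrow> (\<forall>p\<in>\<Phi>. sat M v p)" by auto
  with insert.prems[of p] show ?case by (intro exI[of _ "Conj p q"]) auto
qed

text \<open>Substituting a variable \<open>s j\<close> for a variable \<open>j\<close> in \<open>q\<close> is expressed by the formula
  \<open>\<exists>j. j = s j \<and> q\<close>. This cannot capture variables, whatever \<open>q\<close> binds, and two variables may have the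
  same target. The targets lie outside \<open>I\<close> so that the substitutions for the elements of \<open>I\<close>, which are
  carried out one after the other, do not interfere.\<close>

lemma ex_fresh_subst:
  assumes "finite I" "wf_fm L p" "s ` I \<inter> I = {}"
  shows "\<exists>q. wf_fm L q \<and> fv q \<subseteq> (fv p - I) \<union> s ` I \<and>
    (\<forall>(M :: ('a, 'f, 'r) struct) v. range v \<subseteq> universe M \<longrightarrow>
       (sat M v q \<longleftrightarrow> sat M (\<lambda>i. if i \<in> I then v (s i) else v i) p))"
  using assms(1,3)
proof (induction I)
  case empty
  show ?case using assms(2) by (intro exI[of _ p]) auto
next
  case (insert j I)
  then have "s ` I \<inter> I = {}" by auto
  then obtain q where q: "wf_fm L q" "fv q \<subseteq> (fv p - I) \<union> s ` I"
    "\<And>(M :: ('a, 'f, 'r) struct) v. range v \<subseteq> universe M \<Longrightarrow>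
       (sat M v q \<longleftrightarrow> sat M (\<lambda>i. if i \<in> I then v (s i) else v i) p)"
    using insert.IH by auto
  have sj: "s j \<noteq> j" using insert.prems by auto
  have "sat M v (Ex j (Conj (Eq (Var j) (Var (s j))) q)) \<longleftrightarrow>
      sat M (\<lambda>i. if i \<in> insert j I then v (s i) else v i) p"
    if "range v \<subseteq> universe M" for M :: "('a, 'f, 'r) struct" and v
  proof -
    have "sat M v (Ex j (Conj (Eq (Var j) (Var (s j))) q)) \<longleftrightarrow> sat M (v(j := v (s j))) q"
      using that sj by auto
    also have "\<dots> \<longleftrightarrow> sat M (\<lambda>i. if i \<in> I then (v(j := v (s j))) (s i) else (v(j := v (s j))) i) p"
      using that by (intro q(3)) auto
    also have "\<dots> \<longleftrightarrow> sat M (\<lambda>i. if i \<in> insert j I then v (s i) else v i) p"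
      by (rule sat_cong) (use insert.prems insert.hyps in auto)
    finally show ?thesis .
  qed
  moreover have "fv (Ex j (Conj (Eq (Var j) (Var (s j))) q)) \<subseteq> (fv p - insert j I) \<union> s ` insert j I"
    using q(2) sj insert.prems by auto
  ultimately show ?case using q(1)
    by (intro exI[of _ "Ex j (Conj (Eq (Var j) (Var (s j))) q)"]) auto
qed

text \<open>An arbitrary change of variables, possibly a permutation or not injective, is done in two steps:
  first all free variables move above a bound \<open>K\<close>, then from there to their targets. Neither step
  reads a variable that it also substitutes.\<close>

lemma ex_subst:
  assumes "wf_fm L p"
  shows "\<exists>q. wf_fm L q \<and> fv q \<subseteq> f ` fv p \<and>
    (\<forall>(M :: ('a, 'f, 'r) struct) v. range v \<subseteq> universe M \<longrightarrow> (sat M v q \<longleftrightarrow> sat M (v \<circ> f) p))"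
proof -
  have "finite (fv p \<union> f ` fv p)" by (simp add: finite_fv)
  then obtain K where "\<forall>i\<in>fv p \<union> f ` fv p. i < K"
    unfolding finite_nat_set_iff_bounded by (elim exE)
  then have K: "\<And>i. i \<in> fv p \<Longrightarrow> i < K" "\<And>i. i \<in> fv p \<Longrightarrow> f i < K" by auto
  define I where "I = (\<lambda>i. i + K) ` fv p"
  have "(\<lambda>i. i + K) ` fv p \<inter> fv p = {}" by (auto dest: K(1))
  from ex_fresh_subst[OF finite_fv assms this]
  obtain q where q: "wf_fm L q" "fv q \<subseteq> I"
    "\<And>(M :: ('a, 'f, 'r) struct) v. range v \<subseteq> universe M \<Longrightarrow>
       (sat M v q \<longleftrightarrow> sat M (\<lambda>i. if i \<in> fv p then v (i + K) else v i) p)"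
    unfolding I_def by auto
  have "finite I" by (simp add: I_def finite_fv)
  moreover have "(\<lambda>j. f (j - K)) ` I \<inter> I = {}" by (auto simp: I_def dest: K(2))
  ultimately obtain q' where q': "wf_fm L q'" "fv q' \<subseteq> (fv q - I) \<union> (\<lambda>j. f (j - K)) ` I"
    "\<And>(M :: ('a, 'f, 'r) struct) v. range v \<subseteq> universe M \<Longrightarrow>
       (sat M v q' \<longleftrightarrow> sat M (\<lambda>j. if j \<in> I then v (f (j - K)) else v j) q)"
    using ex_fresh_subst[OF _ q(1), of I "\<lambda>j. f (j - K)"] by auto
  have "fv q' \<subseteq> f ` fv p" using q(2) q'(2) by (auto simp: I_def)
  moreover have "sat M v q' \<longleftrightarrow> sat M (v \<circ> f) p"
    if v: "range v \<subseteq> universe M" for M :: "('a, 'f, 'r) struct" and v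
  proof -
    let ?w = "\<lambda>j. if j \<in> I then v (f (j - K)) else v j"
    have "sat M v q' \<longleftrightarrow> sat M ?w q" by (rule q'(3)[OF v])
    also have "\<dots> \<longleftrightarrow> sat M (\<lambda>i. if i \<in> fv p then ?w (i + K) else ?w i) p"
      using v by (intro q(3)) auto
    also have "\<dots> \<longleftrightarrow> sat M (v \<circ> f) p" by (rule sat_cong) (auto simp: I_def)
    finally show ?thesis .
  qed
  ultimately show ?thesis using q'(1) by blast
qed

section \<open>Finite partial elementary maps\<close>

text \<open>The assignments \<open>v\<close> and \<open>w\<close> may repeat values. Thus the condition does not depend on an enumeration
  of \<open>r\<close>, and applies directly to tuples with repeated entries. The empty relation belongs to the set exactly if
  \<open>M\<close> and \<open>N\<close> are elementarily equivalent.\<close>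

definition fin_partial_elem ::
    "('f, 'r) lang \<Rightarrow> ('a, 'f, 'r) struct \<Rightarrow> ('a, 'f, 'r) struct \<Rightarrow> ('a \<times> 'a) set set" where
  "fin_partial_elem L M N = {r. finite r \<and> r \<subseteq> universe M \<times> universe N \<and>
     (\<forall>p v w. wf_fm L p \<longrightarrow> (\<forall>i\<in>fv p. (v i, w i) \<in> r) \<longrightarrow> (sat M v p \<longleftrightarrow> sat N w p))}"

lemma fin_partial_elem_sat:
  "r \<in> fin_partial_elem L M N \<Longrightarrow> wf_fm L p \<Longrightarrow> (\<And>i. i \<in> fv p \<Longrightarrow> (v i, w i) \<in> r) \<Longrightarrow>
    sat M v p \<longleftrightarrow> sat N w p"
  unfolding fin_partial_elem_def by blast

lemma fin_partial_elem_converse: "r \<in> fin_partial_elem L M N \<Longrightarrow> r\<inverse> \<in> fin_partial_elem L N M"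
  unfolding fin_partial_elem_def by blast

lemma fin_partial_elem_eq_iff:
  assumes "r \<in> fin_partial_elem L M N" "(x, x') \<in> r" "(y, y') \<in> r"
  shows "x = y \<longleftrightarrow> x' = y'"
  using fin_partial_elem_sat[OF assms(1), of "Eq (Var 0) (Var 1)"
      "\<lambda>i. if i = 0 then x else y" "\<lambda>i. if i = 0 then x' else y'"] assms(2,3) by auto

lemma elementary_substructure_Id_on:
  assumes "elementary_substructure L M N" "finite A" "A \<subseteq> universe M"
  shows "Id_on A \<in> fin_partial_elem L M N"
proof -
  from assms(1) have U: "universe M \<subseteq> universe N" "universe M \<noteq> {}"
    and el: "\<And>p v. wf_fm L p \<Longrightarrow> range v \<subseteq> universe M \<Longrightarrow> sat M v p \<longleftrightarrow> sat N v p"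
    by (auto simp: elementary_substructure_def substructure_def is_structure_def)
  obtain a where a: "a \<in> universe M" using U by auto
  have "sat M v p \<longleftrightarrow> sat N w p" if p: "wf_fm L p" and vw: "\<forall>i\<in>fv p. (v i, w i) \<in> Id_on A" for p v w
  proof -
    let ?u = "\<lambda>i. if i \<in> fv p then v i else a"
    have "sat M v p \<longleftrightarrow> sat M ?u p" by (rule sat_cong) simp
    also have "\<dots> \<longleftrightarrow> sat N ?u p" by (rule el[OF p]) (use vw a assms(3) in auto)
    also have "\<dots> \<longleftrightarrow> sat N w p" by (rule sat_cong) (use vw in auto)
    finally show ?thesis .
  qed
  moreover have "finite (Id_on A)" using assms(2) by (simp add: Id_on_def)
  ultimately show ?thesis using U assms(3) unfolding fin_partial_elem_def by auto
qed

text \<open>Enumerate \<open>r\<close> as \<open>rs\<close> and let variable \<open>i \<ge> 1\<close> stand for its \<open>i\<close>th pair and variable \<open>0\<close> for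
  the new element. The formulas over variables \<open>0, \<dots>, k\<close> that \<open>a\<close> satisfies become a type \<open>\<Gamma>\<close> over
  the range of \<open>r\<close>. It is finitely satisfiable in \<open>N\<close>: quantify the conjunction of a finite part
  existentially over variable \<open>0\<close>, and \<open>r\<close> preserves the resulting formula. So saturation gives \<open>b\<close>.
  As \<open>\<Gamma>\<close> contains each formula or its negation, \<open>b\<close> and \<open>a\<close> satisfy the same formulas.\<close>

lemma fin_partial_elem_forth:
  fixes M N :: "('a, 'f, 'r) struct"
  assumes sat: "aleph0_saturated L N" and r: "r \<in> fin_partial_elem L M N" and a: "a \<in> universe M"
  shows "\<exists>b\<in>universe N. insert (a, b) r \<in> fin_partial_elem L M N"
proof -
  have fin: "finite r" and sub: "r \<subseteq> universe M \<times> universe N"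
    using r by (auto simp: fin_partial_elem_def)
  obtain rs where rs: "set rs = r" using fin finite_list by blast
  define k where "k = length rs"
  define v where "v i = (if 1 \<le> i \<and> i \<le> k then fst (rs ! (i - 1)) else a)" for i
  define w where "w i = snd (rs ! (i - 1))" for i
  have vw: "(v i, w i) \<in> r" if "i \<in> {1..k}" for i
  proof -
    have "rs ! (i - 1) \<in> r" using that unfolding rs[symmetric] k_def by (intro nth_mem) auto
    then show ?thesis using that by (simp add: v_def w_def)
  qed
  have v0: "v(0 := a) = v" by (auto simp: v_def)
  define \<Gamma> where "\<Gamma> = {p. wf_fm L p \<and> fv p \<subseteq> {..k} \<and> sat M v p} \<times> {w}"
  have sol: "[b] \<in> solutions N 1 (p, w) \<longleftrightarrow> b \<in> universe N \<and> sat N (w(0 := b)) p" for b p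
  proof -
    have "(\<lambda>i. if i < 1 then [b] ! i else w i) = w(0 := b)" by auto
    then show ?thesis unfolding solutions_def fst_conv snd_conv by (simp add: tuples_def)
  qed
  have over: "\<Gamma> \<subseteq> pfms_over L (snd ` r) 1"
  proof -
    have "w i \<in> snd ` r" if "p \<in> {p. fv p \<subseteq> {..k}}" "i \<in> fv p" "1 \<le> i" for p :: "('f, 'r) fm" and i
    proof -
      have "(v i, w i) \<in> r" using that by (intro vw) auto
      then show ?thesis by force
    qed
    then show ?thesis unfolding \<Gamma>_def pfms_over_def by auto
  qed
  have consistent: "\<exists>b\<in>universe N. \<forall>P\<in>\<Delta>. [b] \<in> solutions N 1 P"
    if \<Delta>: "finite \<Delta>" "\<Delta> \<subseteq> \<Gamma>" for \<Delta>
  proof -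
    have mem: "wf_fm L p \<and> fv p \<subseteq> {..k} \<and> sat M v p \<and> u = w" if "(p, u) \<in> \<Delta>" for p u
      using subsetD[OF \<Delta>(2) that] by (simp add: \<Gamma>_def)
    then have "\<And>p. p \<in> fst ` \<Delta> \<Longrightarrow> wf_fm L p \<and> fv p \<subseteq> {..k}" by fastforce
    then obtain q where q: "wf_fm L q" "fv q \<subseteq> {..k}"
      "\<And>(M :: ('a, 'f, 'r) struct) v. sat M v q \<longleftrightarrow> (\<forall>p\<in>fst ` \<Delta>. sat M v p)"
      using ex_finite_conj[of "fst ` \<Delta>" 0 "{..k}" L, where ?'a = 'a] \<Delta>(1) by auto
    have "sat M v q" using mem by (fastforce simp: q(3))
    then have "sat M v (Ex 0 q)" unfolding sat.simps using a by (intro bexI[of _ a]) (simp_all only: v0)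
    moreover have "sat M v (Ex 0 q) \<longleftrightarrow> sat N w (Ex 0 q)"
    proof (rule fin_partial_elem_sat[OF r])
      show "wf_fm L (Ex 0 q)" using q(1) by simp
      fix i assume "i \<in> fv (Ex 0 q)"
      then have "i \<in> {1..k}" using q(2) by (auto simp: Suc_le_eq)
      then show "(v i, w i) \<in> r" by (rule vw)
    qed
    ultimately obtain b where "b \<in> universe N" "sat N (w(0 := b)) q" by auto
    moreover have "[b] \<in> solutions N 1 P" if P: "P \<in> \<Delta>" for P
    proof -
      obtain p where "P = (p, w)" "p \<in> fst ` \<Delta>" using mem P by (cases P) force
      then show ?thesis using \<open>b \<in> universe N\<close> \<open>sat N (w(0 := b)) q\<close> by (simp only: sol q(3))
    qed
    ultimately show ?thesis by blast
  qed
  have "finite (snd ` r)" "snd ` r \<subseteq> universe N" using fin sub by auto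
  with over consistent have "\<exists>b\<in>universe N. \<forall>P\<in>\<Gamma>. [b] \<in> solutions N 1 P"
    using sat unfolding aleph0_saturated_def by presburger
  then obtain b where b: "b \<in> universe N"
    and "\<And>p. wf_fm L p \<Longrightarrow> fv p \<subseteq> {..k} \<Longrightarrow> sat M v p \<Longrightarrow> sat N (w(0 := b)) p"
    using sol by (auto simp: \<Gamma>_def)
  from this(2) this(2)[of "Neg _"]
  have iff: "sat M v p \<longleftrightarrow> sat N (w(0 := b)) p" if "wf_fm L p" "fv p \<subseteq> {..k}" for p
    using that by auto
  \<comment> \<open>Outside \<open>1, \<dots>, k\<close> the values of \<open>w\<close> are unspecified, but substitution in formulas needs all values
       in the universe.\<close>
  let ?w = "\<lambda>i. if 1 \<le> i \<and> i \<le> k then w i else b"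
  have v_range: "range v \<subseteq> universe M" and w_range: "range ?w \<subseteq> universe N"
    using vw sub a b by (force simp: v_def)+
  have "sat M x p \<longleftrightarrow> sat N y p"
    if p: "wf_fm L p" and xy: "\<forall>i\<in>fv p. (x i, y i) \<in> insert (a, b) r" for p x y
  proof -
    \<comment> \<open>Renaming each free variable to the position of its pair reduces to the case of the
         enumeration.\<close>
    have "\<exists>j\<le>k. x i = v j \<and> y i = ?w j" if "i \<in> fv p" for i
    proof (cases "(x i, y i) = (a, b)")
      case True
      then show ?thesis by (intro exI[of _ 0]) (auto simp: v_def)
    next
      case False
      then have "(x i, y i) \<in> set rs" using xy that rs by auto
      then obtain j where "j < k" "rs ! j = (x i, y i)" by (auto simp: in_set_conv_nth k_def)
      then show ?thesis by (intro exI[of _ "Suc j"]) (auto simp: v_def w_def)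
    qed
    then obtain f where f: "\<And>i. i \<in> fv p \<Longrightarrow> f i \<le> k \<and> x i = v (f i) \<and> y i = ?w (f i)" by metis
    obtain q where q: "wf_fm L q" "fv q \<subseteq> f ` fv p"
      "\<And>(M :: ('a, 'f, 'r) struct) v. range v \<subseteq> universe M \<Longrightarrow> (sat M v q \<longleftrightarrow> sat M (v \<circ> f) p)"
      using ex_subst[OF p, of f, where ?'a = 'a] by auto
    have fvq: "fv q \<subseteq> {..k}" using q(2) f by auto
    have "sat M x p \<longleftrightarrow> sat M (v \<circ> f) p" by (rule sat_cong) (simp add: f)
    also have "\<dots> \<longleftrightarrow> sat M v q" using q(3)[OF v_range] by simp
    also have "\<dots> \<longleftrightarrow> sat N (w(0 := b)) q" by (rule iff[OF q(1) fvq])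
    also have "\<dots> \<longleftrightarrow> sat N ?w q" by (rule sat_cong) (use fvq in auto)
    also have "\<dots> \<longleftrightarrow> sat N (?w \<circ> f) p" by (rule q(3)[OF w_range])
    also have "\<dots> \<longleftrightarrow> sat N y p" by (rule sat_cong) (simp add: f)
    finally show ?thesis .
  qed
  then show ?thesis using a b fin sub unfolding fin_partial_elem_def by blast
qed

abbreviation matched :: "('a \<times> 'b) set \<Rightarrow> 'a list \<Rightarrow> 'b list \<Rightarrow> bool" where
  "matched r \<equiv> list_all2 (\<lambda>x y. (x, y) \<in> r)"

lemma matched_mono: "matched r xs ys \<Longrightarrow> r \<subseteq> r' \<Longrightarrow> matched r' xs ys"
  by (erule list_all2_mono) auto

lemma matched_converse: "matched (r\<inverse>) ys xs \<longleftrightarrow> matched r xs ys"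
  by (auto simp: list_all2_conv_all_nth)

lemma fin_partial_elem_forth_tuple:
  assumes "aleph0_saturated L N" "r \<in> fin_partial_elem L M N" "set xs \<subseteq> universe M"
  shows "\<exists>r'\<in>fin_partial_elem L M N. r \<subseteq> r' \<and> (\<exists>ys. matched r' xs ys)"
  using assms(3)
proof (induction xs)
  case Nil
  then show ?case using assms(2) by blast
next
  case (Cons x xs)
  then obtain r' ys where r': "r' \<in> fin_partial_elem L M N" "r \<subseteq> r'" "matched r' xs ys" by auto
  obtain y where "insert (x, y) r' \<in> fin_partial_elem L M N"
    using fin_partial_elem_forth[OF assms(1) r'(1)] Cons.prems by auto
  moreover have "matched (insert (x, y) r') xs ys"
    by (rule matched_mono[OF r'(3)]) auto
  then have "matched (insert (x, y) r') (x # xs) (y # ys)" by simp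
  ultimately show ?case using r'(2) by blast
qed

lemma fin_partial_elem_back_tuple:
  assumes "aleph0_saturated L M" "r \<in> fin_partial_elem L M N" "set ys \<subseteq> universe N"
  shows "\<exists>r'\<in>fin_partial_elem L M N. r \<subseteq> r' \<and> (\<exists>xs. matched r' xs ys)"
proof -
  obtain r' xs where r': "r' \<in> fin_partial_elem L N M" "r\<inverse> \<subseteq> r'" "matched r' ys xs"
    using fin_partial_elem_forth_tuple[OF assms(1) fin_partial_elem_converse[OF assms(2)] assms(3)] by auto
  show ?thesis
  proof (intro bexI[of _ "r'\<inverse>"] conjI exI[of _ xs])
    show "r'\<inverse> \<in> fin_partial_elem L M N" by (rule fin_partial_elem_converse[OF r'(1)])
    show "r \<subseteq> r'\<inverse>" using r'(2) by (simp only: converse_subset_swap)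
    show "matched (r'\<inverse>) xs ys" using r'(3) by (simp only: matched_converse)
  qed
qed

lemma fin_partial_elem_matched_eq_iff:
  assumes "r \<in> fin_partial_elem L M N" "matched r xs ys" "matched r xs' ys'"
  shows "xs = xs' \<longleftrightarrow> ys = ys'"
proof -
  have "xs ! i = xs' ! i \<longleftrightarrow> ys ! i = ys' ! i" if "i < length xs" "i < length xs'" for i
    by (rule fin_partial_elem_eq_iff[OF assms(1)]) (use assms(2,3) that in \<open>auto dest: list_all2_nthD\<close>)
  then show ?thesis
    using assms(2,3)[THEN list_all2_lengthD] by (simp add: list_eq_iff_nth_eq) metis
qed

lemma fin_partial_elem_solutions_iff:
  assumes r: "r \<in> fin_partial_elem L M N" and p: "wf_fm L p"
    and c: "\<And>i. i \<in> fv p \<Longrightarrow> n \<le> i \<Longrightarrow> (c i, c' i) \<in> r"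
    and xs: "matched r xs ys"
  shows "xs \<in> solutions M n (p, c) \<longleftrightarrow> ys \<in> solutions N n (p, c')"
proof -
  have len: "length xs = length ys" using xs by (rule list_all2_lengthD)
  have r_sub: "r \<subseteq> universe M \<times> universe N" using r by (simp add: fin_partial_elem_def)
  have U: "set xs \<subseteq> universe M" "set ys \<subseteq> universe N"
    using xs r_sub by (fastforce simp: list_all2_conv_all_nth in_set_conv_nth)+
  have "sat M (\<lambda>i. if i < n then xs ! i else c i) p \<longleftrightarrow> sat N (\<lambda>i. if i < n then ys ! i else c' i) p"
    if "length xs = n"
    by (rule fin_partial_elem_sat[OF r p]) (use that c xs in \<open>auto simp: list_all2_conv_all_nth\<close>)
  then show ?thesis using len U unfolding solutions_def fst_conv snd_conv
    by (auto simp: tuples_def)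
qed

section \<open>Groups linked by a back-and-forth system\<close>

text \<open>A back-and-forth system of partial isomorphisms. Its members are not restricted to finite
  relations, because they will be the maps on tuples induced by finite maps on elements. Both sides are
  merely closed under multiplication, so that the group axioms of \<open>H\<close> can be derived from those of
  \<open>G\<close> inside the locale.\<close>

locale back_and_forth =
  fixes G (structure) and H (structure) and B :: "('g \<times> 'h) set set"
  assumes nonempty: "B \<noteq> {}"
    and subset: "R \<in> B \<Longrightarrow> R \<subseteq> carrier G \<times> carrier H"
    and eq_iff: "R \<in> B \<Longrightarrow> (x, x') \<in> R \<Longrightarrow> (y, y') \<in> R \<Longrightarrow> x = y \<longleftrightarrow> x' = y'"
    and mult_iff: "R \<in> B \<Longrightarrow> (x, x') \<in> R \<Longrightarrow> (y, y') \<in> R \<Longrightarrow> (z, z') \<in> R \<Longrightarrow>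
      x \<otimes>\<^bsub>G\<^esub> y = z \<longleftrightarrow> x' \<otimes>\<^bsub>H\<^esub> y' = z'"
    and forward: "R \<in> B \<Longrightarrow> x \<in> carrier G \<Longrightarrow> \<exists>R'\<in>B. R \<subseteq> R' \<and> (\<exists>x'. (x, x') \<in> R')"
    and backward: "R \<in> B \<Longrightarrow> x' \<in> carrier H \<Longrightarrow> \<exists>R'\<in>B. R \<subseteq> R' \<and> (\<exists>x. (x, x') \<in> R')"
    and closed_G: "x \<in> carrier G \<Longrightarrow> y \<in> carrier G \<Longrightarrow> x \<otimes>\<^bsub>G\<^esub> y \<in> carrier G"
    and closed_H: "x' \<in> carrier H \<Longrightarrow> y' \<in> carrier H \<Longrightarrow> x' \<otimes>\<^bsub>H\<^esub> y' \<in> carrier H"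
begin

lemma extend_mult:
  assumes "R \<in> B" "(x, x') \<in> R" "(y, y') \<in> R"
  shows "\<exists>R'\<in>B. R \<subseteq> R' \<and> (x \<otimes>\<^bsub>G\<^esub> y, x' \<otimes>\<^bsub>H\<^esub> y') \<in> R'"
proof -
  have "x \<otimes>\<^bsub>G\<^esub> y \<in> carrier G" using assms subset closed_G by blast
  then obtain R' z' where R': "R' \<in> B" "R \<subseteq> R'" "(x \<otimes>\<^bsub>G\<^esub> y, z') \<in> R'"
    using forward[OF assms(1)] by blast
  then have "x' \<otimes>\<^bsub>H\<^esub> y' = z'" using mult_iff[OF R'(1) _ _ R'(3)] assms(2,3) by blast
  then show ?thesis using R' by blast
qed

lemma forth_finite:
  assumes "R \<in> B" "finite S" "S \<subseteq> carrier G"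
  shows "\<exists>R'\<in>B. R \<subseteq> R' \<and> (\<exists>\<phi>. \<forall>x\<in>S. (x, \<phi> x) \<in> R')"
proof -
  have "\<exists>R'\<in>B. R \<subseteq> R' \<and> (\<forall>x\<in>S. \<exists>x'. (x, x') \<in> R')"
    using assms(2,3)
  proof (induction S)
    case empty
    then show ?case using assms(1) by blast
  next
    case (insert x S)
    then obtain R' where R': "R' \<in> B" "R \<subseteq> R'" "\<forall>x\<in>S. \<exists>x'. (x, x') \<in> R'" by auto
    obtain R'' x' where R'': "R'' \<in> B" "R' \<subseteq> R''" "(x, x') \<in> R''"
      using forward[OF R'(1), of x] insert.prems by auto
    have "\<forall>y\<in>insert x S. \<exists>y'. (y, y') \<in> R''" using R'(3) R''(2,3) by blast
    then show ?case using R'(2) R''(1,2) by blast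
  qed
  then show ?thesis by metis
qed

lemma symmetric: "back_and_forth H G (converse ` B)"
proof
  show "converse ` B \<noteq> {}" using nonempty by simp
next
  fix R x x' y y'
  assume "R \<in> converse ` B" "(x, x') \<in> R" "(y, y') \<in> R"
  then show "x = y \<longleftrightarrow> x' = y'" using eq_iff by fastforce
next
  fix R x x' y y' z z'
  assume "R \<in> converse ` B" "(x, x') \<in> R" "(y, y') \<in> R" "(z, z') \<in> R"
  then show "x \<otimes>\<^bsub>H\<^esub> y = z \<longleftrightarrow> x' \<otimes>\<^bsub>G\<^esub> y' = z'" using mult_iff by fastforce
next
  fix R x
  assume "R \<in> converse ` B" "x \<in> carrier H"
  then obtain R' y where "R' \<in> B" "R\<inverse> \<subseteq> R'" "(y, x) \<in> R'" using backward[of "R\<inverse>" x] by auto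
  then show "\<exists>R'\<in>converse ` B. R \<subseteq> R' \<and> (\<exists>x'. (x, x') \<in> R')"
    by (intro bexI[of _ "R'\<inverse>"]) auto
next
  fix R x'
  assume "R \<in> converse ` B" "x' \<in> carrier G"
  then obtain R' y where "R' \<in> B" "R\<inverse> \<subseteq> R'" "(x', y) \<in> R'" using forward[of "R\<inverse>" x'] by auto
  then show "\<exists>R'\<in>converse ` B. R \<subseteq> R' \<and> (\<exists>x. (x, x') \<in> R')"
    by (intro bexI[of _ "R'\<inverse>"]) auto
qed (use subset closed_G closed_H in blast)+

lemma back_finite:
  assumes "R \<in> B" "finite S" "S \<subseteq> carrier H"
  shows "\<exists>R'\<in>B. R \<subseteq> R' \<and> (\<exists>\<phi>. \<forall>x\<in>S. (\<phi> x, x) \<in> R')"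
proof -
  interpret sym: back_and_forth H G "converse ` B" by (rule symmetric)
  show ?thesis using sym.forth_finite[of "R\<inverse>" S] assms by simp
qed

lemma extend_chi:
  assumes "R \<in> B" "\<And>i. i \<in> {1..m+1} \<Longrightarrow> (a i, a' i) \<in> R"
    "\<And>i. i \<in> {1..m} \<Longrightarrow> (f (t i), f' (t i)) \<in> R"
  shows "\<exists>R'\<in>B. R \<subseteq> R' \<and> (chi G m a t f, chi H m a' t f') \<in> R'"
  using assms(2,3)
proof (induction m)
  case 0
  then show ?case using assms(1) by auto
next
  case (Suc m)
  then obtain R1 where R1: "R1 \<in> B" "R \<subseteq> R1" "(chi G m a t f, chi H m a' t f') \<in> R1" by auto
  have "(f (t (Suc m)), f' (t (Suc m))) \<in> R1" using Suc.prems(2)[of "Suc m"] R1(2) by auto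
  from extend_mult[OF R1(1,3) this]
  obtain R2 where R2: "R2 \<in> B" "R1 \<subseteq> R2"
    "(chi G m a t f \<otimes>\<^bsub>G\<^esub> f (t (Suc m)), chi H m a' t f' \<otimes>\<^bsub>H\<^esub> f' (t (Suc m))) \<in> R2" by auto
  have "(a (Suc (Suc m)), a' (Suc (Suc m))) \<in> R2"
    using Suc.prems(1)[of "Suc (Suc m)"] R1(2) R2(2) by auto
  from extend_mult[OF R2(1,3) this] show ?case using R1(2) R2(2) by auto
qed

text \<open>Each group axiom is an assertion about finitely many elements, which can be matched in \<open>G\<close>. The
  unit of \<open>H\<close> is stated by its property, because the field \<open>\<one>\<^bsub>H\<^esub>\<close> of the record is unconstrained.\<close>

lemma group_transfer:
  assumes "group G"
  shows "\<forall>x\<in>carrier H. \<forall>y\<in>carrier H. \<forall>z\<in>carrier H. x \<otimes>\<^bsub>H\<^esub> y \<otimes>\<^bsub>H\<^esub> z = x \<otimes>\<^bsub>H\<^esub> (y \<otimes>\<^bsub>H\<^esub> z)"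
    and "\<exists>e\<in>carrier H. \<forall>x\<in>carrier H. e \<otimes>\<^bsub>H\<^esub> x = x \<and> x \<otimes>\<^bsub>H\<^esub> e = x \<and>
      (\<exists>y\<in>carrier H. y \<otimes>\<^bsub>H\<^esub> x = e)"
proof -
  interpret group G by fact
  obtain R where R: "R \<in> B" using nonempty by auto
  show "\<forall>x\<in>carrier H. \<forall>y\<in>carrier H. \<forall>z\<in>carrier H. x \<otimes>\<^bsub>H\<^esub> y \<otimes>\<^bsub>H\<^esub> z = x \<otimes>\<^bsub>H\<^esub> (y \<otimes>\<^bsub>H\<^esub> z)"
  proof (intro ballI)
    fix x' y' z' assume "x' \<in> carrier H" "y' \<in> carrier H" "z' \<in> carrier H"
    then obtain R1 \<phi> where R1: "R1 \<in> B" "\<forall>u\<in>{x', y', z'}. (\<phi> u, u) \<in> R1"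
      using back_finite[OF R, of "{x', y', z'}"] by auto
    then obtain x y z where xyz: "(x, x') \<in> R1" "(y, y') \<in> R1" "(z, z') \<in> R1" by blast
    obtain R2 where R2: "R2 \<in> B" "R1 \<subseteq> R2" "(x \<otimes>\<^bsub>G\<^esub> y, x' \<otimes>\<^bsub>H\<^esub> y') \<in> R2"
      using extend_mult[OF R1(1) xyz(1,2)] by auto
    obtain R3 where R3: "R3 \<in> B" "R2 \<subseteq> R3" "(y \<otimes>\<^bsub>G\<^esub> z, y' \<otimes>\<^bsub>H\<^esub> z') \<in> R3"
      using extend_mult[OF R2(1), of y y' z z'] R2(2) xyz by auto
    obtain R4 where R4: "R4 \<in> B" "R3 \<subseteq> R4" "(x \<otimes>\<^bsub>G\<^esub> y \<otimes>\<^bsub>G\<^esub> z, x' \<otimes>\<^bsub>H\<^esub> y' \<otimes>\<^bsub>H\<^esub> z') \<in> R4"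
      using extend_mult[OF R3(1), of "x \<otimes>\<^bsub>G\<^esub> y" "x' \<otimes>\<^bsub>H\<^esub> y'" z z'] R2 R3 xyz by blast
    obtain R5 where R5: "R5 \<in> B" "R4 \<subseteq> R5" "(x \<otimes>\<^bsub>G\<^esub> (y \<otimes>\<^bsub>G\<^esub> z), x' \<otimes>\<^bsub>H\<^esub> (y' \<otimes>\<^bsub>H\<^esub> z')) \<in> R5"
      using extend_mult[OF R4(1), of x x' "y \<otimes>\<^bsub>G\<^esub> z" "y' \<otimes>\<^bsub>H\<^esub> z'"] R2 R3 R4 xyz by blast
    have "x \<in> carrier G" "y \<in> carrier G" "z \<in> carrier G" using xyz subset[OF R1(1)] by auto
    then have "x \<otimes>\<^bsub>G\<^esub> y \<otimes>\<^bsub>G\<^esub> z = x \<otimes>\<^bsub>G\<^esub> (y \<otimes>\<^bsub>G\<^esub> z)" by (rule m_assoc)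
    then show "x' \<otimes>\<^bsub>H\<^esub> y' \<otimes>\<^bsub>H\<^esub> z' = x' \<otimes>\<^bsub>H\<^esub> (y' \<otimes>\<^bsub>H\<^esub> z')"
      using eq_iff[OF R5(1) _ R5(3)] R4(3) R5(2) by blast
  qed
  obtain R1 e where R1: "R1 \<in> B" "(\<one>\<^bsub>G\<^esub>, e) \<in> R1" using forward[OF R one_closed] by auto
  show "\<exists>e\<in>carrier H. \<forall>x\<in>carrier H. e \<otimes>\<^bsub>H\<^esub> x = x \<and> x \<otimes>\<^bsub>H\<^esub> e = x \<and>
      (\<exists>y\<in>carrier H. y \<otimes>\<^bsub>H\<^esub> x = e)"
  proof (intro bexI[of _ e] ballI)
    show "e \<in> carrier H" using R1 subset by blast
    fix x' assume "x' \<in> carrier H"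
    then obtain R2 x where R2: "R2 \<in> B" "R1 \<subseteq> R2" "(x, x') \<in> R2" using backward[OF R1(1)] by blast
    have x: "x \<in> carrier G" using R2 subset by blast
    obtain R3 y' where R3: "R3 \<in> B" "R2 \<subseteq> R3" "(inv\<^bsub>G\<^esub> x, y') \<in> R3"
      using forward[OF R2(1), of "inv\<^bsub>G\<^esub> x"] x by auto
    have mem: "(\<one>\<^bsub>G\<^esub>, e) \<in> R3" "(x, x') \<in> R3" using R1 R2 R3 by auto
    show "e \<otimes>\<^bsub>H\<^esub> x' = x' \<and> x' \<otimes>\<^bsub>H\<^esub> e = x' \<and> (\<exists>y\<in>carrier H. y \<otimes>\<^bsub>H\<^esub> x' = e)"
    proof (intro conjI bexI[of _ y'])
      show "e \<otimes>\<^bsub>H\<^esub> x' = x'" using mult_iff[OF R3(1) mem(1,2,2)] x by simp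
      show "x' \<otimes>\<^bsub>H\<^esub> e = x'" using mult_iff[OF R3(1) mem(2,1,2)] x by simp
      show "y' \<otimes>\<^bsub>H\<^esub> x' = e" using mult_iff[OF R3(1) R3(3) mem(2,1)] x by simp
      show "y' \<in> carrier H" using R3 subset by blast
    qed
  qed
qed

end

lemma (in group) mem_l_coset_iff:
  assumes "X \<subseteq> carrier G" "g \<in> carrier G" "x \<in> carrier G"
  shows "x \<in> g <# X \<longleftrightarrow> inv g \<otimes> x \<in> X"
proof
  assume "x \<in> g <# X"
  then obtain y where "y \<in> X" "x = g \<otimes> y" by (auto simp: l_coset_def)
  then show "inv g \<otimes> x \<in> X" using assms by (auto simp: m_assoc[symmetric])
next
  assume "inv g \<otimes> x \<in> X"
  moreover have "x = g \<otimes> (inv g \<otimes> x)" using assms by (simp add: m_assoc[symmetric])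
  ultimately show "x \<in> g <# X" by (auto simp: l_coset_def)
qed

lemma (in group) generic_iff:
  assumes "X \<subseteq> carrier G"
  shows "generic G X \<longleftrightarrow>
    (\<exists>S. finite S \<and> S \<subseteq> carrier G \<and> (\<forall>x\<in>carrier G. \<exists>g\<in>S. g \<otimes> x \<in> X))"
proof
  assume "generic G X"
  then obtain S where S: "finite S" "S \<subseteq> carrier G" "carrier G \<subseteq> (\<Union>g\<in>S. g <# X)"
    by (auto simp: generic_def)
  have "\<forall>x\<in>carrier G. \<exists>g\<in>S. inv g \<otimes> x \<in> X"
    using S(2,3) mem_l_coset_iff[OF assms] by blast
  then show "\<exists>S. finite S \<and> S \<subseteq> carrier G \<and> (\<forall>x\<in>carrier G. \<exists>g\<in>S. g \<otimes> x \<in> X)"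
    using S(1,2) by (intro exI[of _ "m_inv G ` S"]) auto
next
  assume "\<exists>S. finite S \<and> S \<subseteq> carrier G \<and> (\<forall>x\<in>carrier G. \<exists>g\<in>S. g \<otimes> x \<in> X)"
  then obtain S where S: "finite S" "S \<subseteq> carrier G" "\<forall>x\<in>carrier G. \<exists>g\<in>S. g \<otimes> x \<in> X" by auto
  have "carrier G \<subseteq> (\<Union>g\<in>m_inv G ` S. g <# X)"
  proof
    fix x assume x: "x \<in> carrier G"
    then obtain g where g: "g \<in> S" "g \<otimes> x \<in> X" using S by auto
    then have "x \<in> inv g <# X" using S(2) x assms by (subst mem_l_coset_iff) auto
    then show "x \<in> (\<Union>g\<in>m_inv G ` S. g <# X)" using g(1) by auto
  qed
  then show "generic G X" using S(1,2) assms unfolding generic_def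
    by (intro conjI exI[of _ "m_inv G ` S"]) auto
qed

text \<open>This removes the quantifier over arbitrary subsets \<open>Y\<close> of the group. If finitely many
  translates of \<open>X \<union> Y\<close> cover the group, then the complement of the translates of \<open>X\<close> is contained in
  finitely many translates of the non-generic set \<open>Y\<close> and is itself not generic. Conversely that
  complement serves as \<open>Y\<close>. So \<open>X\<close> is weakly generic iff finitely many of its translates have a
  non-generic complement; written out, this is the right-hand side.\<close>

lemma (in group) weakly_generic_iff:
  assumes X: "X \<subseteq> carrier G"
  shows "weakly_generic G X \<longleftrightarrow>
    (\<exists>S. finite S \<and> S \<subseteq> carrier G \<and>
      (\<forall>K. finite K \<longrightarrow> K \<subseteq> carrier G \<longrightarrow> (\<exists>x\<in>carrier G. \<forall>h\<in>K. \<exists>g\<in>S. g \<otimes> (h \<otimes> x) \<in> X)))"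
    (is "_ \<longleftrightarrow> (\<exists>S. ?P S)")
proof
  assume "weakly_generic G X"
  then obtain Y where Y: "Y \<subseteq> carrier G" "\<not> generic G Y" "generic G (X \<union> Y)"
    by (auto simp: weakly_generic_def)
  then obtain S where S: "finite S" "S \<subseteq> carrier G"
    "\<And>x. x \<in> carrier G \<Longrightarrow> \<exists>g\<in>S. g \<otimes> x \<in> X \<union> Y"
    using generic_iff[of "X \<union> Y"] X by auto
  have "?P S"
  proof (intro conjI allI impI S(1,2))
    fix K assume K: "finite K" "K \<subseteq> carrier G"
    let ?T = "(\<lambda>(g, h). g \<otimes> h) ` (S \<times> K)"
    have T: "finite ?T" "?T \<subseteq> carrier G" using S(1,2) K by auto
    have "\<not> (\<forall>x\<in>carrier G. \<exists>g\<in>?T. g \<otimes> x \<in> Y)"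
    proof
      assume "\<forall>x\<in>carrier G. \<exists>g\<in>?T. g \<otimes> x \<in> Y"
      then have "generic G Y" unfolding generic_iff[OF Y(1)] by (intro exI[of _ ?T] conjI T)
      then show False using Y(2) by contradiction
    qed
    then obtain x where "x \<in> carrier G" "\<not> (\<exists>g\<in>?T. g \<otimes> x \<in> Y)" unfolding ball_simps by (elim bexE)
    then have x: "x \<in> carrier G" "\<And>g. g \<in> ?T \<Longrightarrow> g \<otimes> x \<notin> Y" by blast+
    have "\<exists>g\<in>S. g \<otimes> (h \<otimes> x) \<in> X" if h: "h \<in> K" for h
    proof -
      obtain g where g: "g \<in> S" "g \<otimes> (h \<otimes> x) \<in> X \<union> Y" using S(3)[of "h \<otimes> x"] h K x by auto
      have "(g \<otimes> h) \<otimes> x \<notin> Y" using g(1) h by (intro x(2)) auto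
      then have "g \<otimes> (h \<otimes> x) \<notin> Y" using g(1) h S(2) K(2) x(1) by (simp add: m_assoc subset_iff)
      then show ?thesis using g by auto
    qed
    then show "\<exists>x\<in>carrier G. \<forall>h\<in>K. \<exists>g\<in>S. g \<otimes> (h \<otimes> x) \<in> X" using x(1) by auto
  qed
  then show "\<exists>S. ?P S" ..
next
  assume "\<exists>S. ?P S"
  then obtain S where S: "finite S" "S \<subseteq> carrier G"
    "\<And>K. finite K \<Longrightarrow> K \<subseteq> carrier G \<Longrightarrow> \<exists>x\<in>carrier G. \<forall>h\<in>K. \<exists>g\<in>S. g \<otimes> (h \<otimes> x) \<in> X" by auto
  define Y where "Y = {x \<in> carrier G. \<forall>g\<in>S. g \<otimes> x \<notin> X}"
  have Y: "Y \<subseteq> carrier G" by (auto simp: Y_def)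
  have "\<not> generic G Y"
  proof
    assume "generic G Y"
    then obtain K where K: "finite K" "K \<subseteq> carrier G" "\<forall>x\<in>carrier G. \<exists>h\<in>K. h \<otimes> x \<in> Y"
      using generic_iff[OF Y] by auto
    then show False using S(3)[OF K(1,2)] by (fastforce simp: Y_def)
  qed
  \<comment> \<open>The unit is added to the translating elements so that \<open>Y\<close> itself is covered.\<close>
  moreover have "generic G (X \<union> Y)"
  proof -
    have "\<exists>g\<in>insert \<one> S. g \<otimes> x \<in> X \<union> Y" if "x \<in> carrier G" for x
      using that by (auto simp: Y_def)
    then show ?thesis using S(1,2) X Y by (subst generic_iff) (auto intro!: exI[of _ "insert \<one> S"])
  qed
  ultimately show "weakly_generic G X" using X Y by (auto simp: weakly_generic_def)
qed

text \<open>Adding \<open>X\<close> and \<open>Y\<close> to the structure that a back-and-forth system preserves makes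
  \<open>X\<close> in \<open>G\<close> and \<open>Y\<close> in \<open>H\<close> indistinguishable for properties that quantify over finite sets
  of elements, and even over sequences when only finitely many terms of them are used at a time.\<close>

locale back_and_forth_groups = back_and_forth +
  fixes X Y
  assumes group_G: "group G" and group_H: "group H"
    and X_subset: "X \<subseteq> carrier G" and Y_subset: "Y \<subseteq> carrier H"
    and mem_iff: "R \<in> B \<Longrightarrow> (x, y) \<in> R \<Longrightarrow> x \<in> X \<longleftrightarrow> y \<in> Y"
begin

lemma groups_symmetric: "back_and_forth_groups H G (converse ` B) Y X"
proof (intro back_and_forth_groups.intro back_and_forth_groups_axioms.intro symmetric
    group_G group_H X_subset Y_subset)
  fix R x y assume "R \<in> converse ` B" "(x, y) \<in> R"
  then show "x \<in> Y \<longleftrightarrow> y \<in> X" using mem_iff by blast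
qed

text \<open>The characterisation \<open>weakly_generic_iff\<close> is played as a game: \<open>S\<close> is matched by forth moves, \<open>K\<close>
  by back moves and \<open>x\<close> by a forth move; the final \<open>h\<close> and \<open>g\<close> lie in sets that are already matched.\<close>

lemma weakly_generic_forth:
  assumes "weakly_generic G X"
  shows "weakly_generic H Y"
proof -
  interpret G: group G by (rule group_G)
  interpret H: group H by (rule group_H)
  obtain S where S: "finite S" "S \<subseteq> carrier G"
    "\<And>K. finite K \<Longrightarrow> K \<subseteq> carrier G \<Longrightarrow> \<exists>x\<in>carrier G. \<forall>h\<in>K. \<exists>g\<in>S. g \<otimes>\<^bsub>G\<^esub> (h \<otimes>\<^bsub>G\<^esub> x) \<in> X"
    using assms G.weakly_generic_iff[OF X_subset] by auto
  obtain R where "R \<in> B" using nonempty by auto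
  then obtain R1 \<phi> where R1: "R1 \<in> B" "\<forall>g\<in>S. (g, \<phi> g) \<in> R1" using forth_finite S(1,2) by metis
  have "\<exists>x\<in>carrier H. \<forall>h\<in>K. \<exists>g\<in>\<phi> ` S. g \<otimes>\<^bsub>H\<^esub> (h \<otimes>\<^bsub>H\<^esub> x) \<in> Y"
    if K: "finite K" "K \<subseteq> carrier H" for K
  proof -
    obtain R2 \<psi> where R2: "R2 \<in> B" "R1 \<subseteq> R2" "\<forall>h\<in>K. (\<psi> h, h) \<in> R2"
      using back_finite[OF R1(1) K] by auto
    then have "\<psi> ` K \<subseteq> carrier G" using subset by blast
    then obtain x where x: "x \<in> carrier G" "\<forall>h\<in>K. \<exists>g\<in>S. g \<otimes>\<^bsub>G\<^esub> (\<psi> h \<otimes>\<^bsub>G\<^esub> x) \<in> X"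
      using S(3)[of "\<psi> ` K"] K(1) by auto
    obtain R3 x' where R3: "R3 \<in> B" "R2 \<subseteq> R3" "(x, x') \<in> R3" using forward[OF R2(1) x(1)] by auto
    have "\<exists>g\<in>\<phi> ` S. g \<otimes>\<^bsub>H\<^esub> (h \<otimes>\<^bsub>H\<^esub> x') \<in> Y" if "h \<in> K" for h
    proof -
      obtain g where g: "g \<in> S" "g \<otimes>\<^bsub>G\<^esub> (\<psi> h \<otimes>\<^bsub>G\<^esub> x) \<in> X" using x(2) \<open>h \<in> K\<close> by auto
      obtain R4 where R4: "R4 \<in> B" "R3 \<subseteq> R4" "(\<psi> h \<otimes>\<^bsub>G\<^esub> x, h \<otimes>\<^bsub>H\<^esub> x') \<in> R4"
        using extend_mult[OF R3(1), of "\<psi> h" h x x'] R2(3) R3 \<open>h \<in> K\<close> by blast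
      obtain R5 where "R5 \<in> B" "(g \<otimes>\<^bsub>G\<^esub> (\<psi> h \<otimes>\<^bsub>G\<^esub> x), \<phi> g \<otimes>\<^bsub>H\<^esub> (h \<otimes>\<^bsub>H\<^esub> x')) \<in> R5"
        using extend_mult[OF R4(1) _ R4(3), of g "\<phi> g"] R1(2) R2(2) R3(2) R4(2) g(1) by blast
      then show ?thesis using mem_iff g by blast
    qed
    moreover have "x' \<in> carrier H" using R3 subset by blast
    ultimately show ?thesis by blast
  qed
  moreover have "\<phi> ` S \<subseteq> carrier H" using R1 subset by blast
  ultimately show ?thesis unfolding H.weakly_generic_iff[OF Y_subset]
    using S(1) by (intro exI[of _ "\<phi> ` S"]) auto
qed

text \<open>Sequences are infinite objects, but \<open>\<omega>\<close> back moves build a chain \<open>R 0 \<subseteq> R 1 \<subseteq> \<dots>\<close> in which \<open>R k\<close>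
  matches the \<open>k\<close>th terms. A product uses terms up to some index \<open>n\<close> only, all matched in the single
  member \<open>R n\<close> of the system, from which the coefficients are matched by forth moves.\<close>

lemma J_set_forth:
  assumes "J_set G X"
  shows "J_set H Y"
  unfolding J_set_def
proof (intro conjI allI impI Y_subset)
  fix F :: "(nat \<Rightarrow> _) set"
  assume F: "finite F" "F \<subseteq> {1..} \<rightarrow>\<^sub>E carrier H"
  have F_carrier: "f k \<in> carrier H" if "f \<in> F" "1 \<le> k" for f k
    using F(2) that by (auto simp: PiE_def Pi_def)
  \<comment> \<open>Sequences are indexed from \<open>1\<close>; at \<open>0\<close> they take a default value, which is not matched.\<close>
  have ex_match: "\<exists>R'\<in>B. R \<subseteq> R' \<and> (\<forall>f\<in>F. 1 \<le> k \<longrightarrow> (\<exists>x. (x, f k) \<in> R'))" if R: "R \<in> B" for R k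
  proof (cases "1 \<le> k")
    case True
    then have "(\<lambda>f. f k) ` F \<subseteq> carrier H" using F_carrier by auto
    then obtain R' \<psi> where "R' \<in> B" "R \<subseteq> R'" "\<forall>x\<in>(\<lambda>f. f k) ` F. (\<psi> x, x) \<in> R'"
      using back_finite[OF R, of "(\<lambda>f. f k) ` F"] F(1) by auto
    then show ?thesis by auto
  qed (use R in auto)
  have "\<exists>R. \<forall>k::nat. (R k \<in> B \<and> (\<forall>f\<in>F. 1 \<le> k \<longrightarrow> (\<exists>x. (x, f k) \<in> R k))) \<and> R k \<subseteq> R (Suc k)"
  proof (rule dependent_nat_choice)
    obtain R where "R \<in> B" using nonempty by auto
    then show "\<exists>R. R \<in> B \<and> (\<forall>f\<in>F. 1 \<le> (0::nat) \<longrightarrow> (\<exists>x. (x, f 0) \<in> R))" by auto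
    show "\<exists>R'. (R' \<in> B \<and> (\<forall>f\<in>F. 1 \<le> Suc k \<longrightarrow> (\<exists>x. (x, f (Suc k)) \<in> R'))) \<and> R \<subseteq> R'"
      if "R \<in> B \<and> (\<forall>f\<in>F. 1 \<le> k \<longrightarrow> (\<exists>x. (x, f k) \<in> R))" for R k
      using ex_match[of R "Suc k"] that by blast
  qed
  then obtain R where R: "\<And>k. R k \<in> B" "\<And>k. R k \<subseteq> R (Suc k)"
    "\<And>f k. f \<in> F \<Longrightarrow> 1 \<le> k \<Longrightarrow> \<exists>x. (x, f k) \<in> R k" by blast
  have R_mono: "R i \<subseteq> R j" if "i \<le> j" for i j using lift_Suc_mono_le[of R, OF R(2) that] .
  define pre where "pre f = (\<lambda>k\<in>{1..}. SOME x. (x, f k) \<in> R k)" for f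
  have pre: "(pre f k, f k) \<in> R k" if "f \<in> F" "1 \<le> k" for f k
    using someI_ex[OF R(3)[OF that]] that(2) by (simp add: pre_def)
  have "pre ` F \<subseteq> {1..} \<rightarrow>\<^sub>E carrier G"
  proof (intro image_subsetI PiE_I)
    fix f k assume "f \<in> F" "k \<in> {1::nat..}"
    then show "pre f k \<in> carrier G" using pre[of f k] subset[OF R(1), of k] by auto
  qed (simp add: pre_def)
  then obtain m t a where mt: "m \<ge> 1" "t \<in> incr_seqs m" and a: "a \<in> {1..m+1} \<rightarrow>\<^sub>E carrier G"
    and chi: "\<forall>f\<in>F. chi G m a t (pre f) \<in> X"
    using assms F(1) unfolding J_set_def by (metis (no_types, lifting) finite_imageI image_eqI)
  define n where "n = Max (t ` {1..m})"
  have "a ` {1..m+1} \<subseteq> carrier G" using a by auto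
  then obtain R' \<phi> where R': "R' \<in> B" "R n \<subseteq> R'" "\<forall>x\<in>a ` {1..m+1}. (x, \<phi> x) \<in> R'"
    using forth_finite[OF R(1), of "a ` {1..m+1}" n] by auto
  define a' where "a' = (\<lambda>i\<in>{1..m+1}. \<phi> (a i))"
  have aa': "(a i, a' i) \<in> R'" if "i \<in> {1..m+1}" for i using R'(3) that by (auto simp: a'_def)
  have "a' \<in> {1..m+1} \<rightarrow>\<^sub>E carrier H"
    using aa' subset[OF R'(1)] by (intro PiE_I) (auto simp: a'_def)
  moreover have "chi H m a' t f \<in> Y" if f: "f \<in> F" for f
  proof -
    have "(pre f (t i), f (t i)) \<in> R'" if i: "i \<in> {1..m}" for i
    proof -
      have "1 \<le> t i" using mt(2) i by (auto simp: incr_seqs_def PiE_def Pi_def)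
      moreover have "t i \<le> n" unfolding n_def using i by (intro Max_ge) auto
      ultimately show ?thesis using pre[OF f] R_mono R'(2) by blast
    qed
    then obtain R'' where "R'' \<in> B" "(chi G m a t (pre f), chi H m a' t f) \<in> R''"
      using extend_chi[OF R'(1), of m a a' "pre f" t f] aa' by auto
    then show ?thesis using mem_iff chi f by blast
  qed
  ultimately show "\<exists>m\<ge>1. \<exists>t\<in>incr_seqs m. \<exists>a\<in>{1..m+1} \<rightarrow>\<^sub>E carrier H. \<forall>f\<in>F. chi H m a t f \<in> Y"
    using mt by blast
qed

theorem weakly_generic_transfer: "weakly_generic G X \<longleftrightarrow> weakly_generic H Y"
  and J_set_transfer: "J_set G X \<longleftrightarrow> J_set H Y"
proof -
  interpret sym: back_and_forth_groups H G "converse ` B" Y X by (rule groups_symmetric)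
  show "weakly_generic G X \<longleftrightarrow> weakly_generic H Y"
    using weakly_generic_forth sym.weakly_generic_forth by blast
  show "J_set G X \<longleftrightarrow> J_set H Y" using J_set_forth sym.J_set_forth by blast
qed

end

section \<open>Definable groups in two saturated structures\<close>

text \<open>Only these values of the parameter assignments of \<open>G\<close> matter. They are finitely many, so that a
  finite map can fix them all.\<close>

definition grp_params :: "('a, 'f, 'r) grp_fms \<Rightarrow> 'a set" where
  "grp_params G = snd (gset G) ` {i \<in> fv (fst (gset G)). gdim G \<le> i} \<union>
     snd (gmult G) ` {i \<in> fv (fst (gmult G)). 3 * gdim G \<le> i}"

definition mult_functional :: "('a, 'f, 'r) grp_fms \<Rightarrow> ('a, 'f, 'r) struct \<Rightarrow> bool" where
  "mult_functional G M \<longleftrightarrow> (\<forall>x\<in>points G M. \<forall>y\<in>points G M.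
     \<exists>!z. z \<in> points G M \<and> x @ y @ z \<in> solutions M (3 * gdim G) (gmult G))"

lemma finite_grp_params: "finite (grp_params G)"
  by (simp add: grp_params_def finite_fv)

lemma pfms_over_iff:
  "P \<in> pfms_over L A n \<longleftrightarrow> wf_fm L (fst P) \<and> snd P ` {i \<in> fv (fst P). n \<le> i} \<subseteq> A"
  by (cases P) (auto simp: pfms_over_def)

lemma definable_group_iff:
  "definable_group L M G \<longleftrightarrow> grp_params G \<subseteq> universe M \<and> wf_fm L (fst (gset G)) \<and>
     wf_fm L (fst (gmult G)) \<and> mult_functional G M \<and> group (group_of G M)"
  unfolding definable_group_def mult_functional_def pfms_over_iff grp_params_def Un_subset_iff
  by (simp only: conj_ac)

lemma points_subset: "xs \<in> points G M \<Longrightarrow> set xs \<subseteq> universe M"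
  by (auto simp: points_def solutions_def tuples_def)

lemma grp_mult_eq_iff:
  assumes "mult_functional G M" "x \<in> points G M" "y \<in> points G M" "z \<in> points G M"
  shows "grp_mult G M x y = z \<longleftrightarrow> x @ y @ z \<in> solutions M (3 * gdim G) (gmult G)"
proof -
  have ex1: "\<exists>!z. z \<in> points G M \<and> x @ y @ z \<in> solutions M (3 * gdim G) (gmult G)"
    using assms(1-3) by (simp add: mult_functional_def)
  show ?thesis using theI'[OF ex1] ex1 assms(4) unfolding grp_mult_def by blast
qed

lemma grp_mult_closed:
  assumes "mult_functional G M" "x \<in> points G M" "y \<in> points G M"
  shows "grp_mult G M x y \<in> points G M"
proof -
  have ex1: "\<exists>!z. z \<in> points G M \<and> x @ y @ z \<in> solutions M (3 * gdim G) (gmult G)"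
    using assms by (simp add: mult_functional_def)
  show ?thesis using theI'[OF ex1] unfolding grp_mult_def by blast
qed

lemma carrier_group_of: "carrier (group_of G M) = points G M"
  and mult_group_of: "x \<otimes>\<^bsub>group_of G M\<^esub> y = grp_mult G M x y"
  by (simp_all add: group_of_def)

text \<open>The assumptions are symmetric in \<open>M\<close> and \<open>N\<close>, so that everything proved here also holds in the
  opposite direction (\<open>swap\<close>). The map \<open>r0\<close> is a starting position of the game: it fixes the parameters of \<open>G\<close>, and can
  be enlarged so as to match those of a definable set as well.\<close>

locale saturated_pair =
  fixes L :: "('f, 'r) lang" and M N :: "('a, 'f, 'r) struct" and G :: "('a, 'f, 'r) grp_fms"
    and r0 :: "('a \<times> 'a) set"
  assumes saturated_M: "aleph0_saturated L M" and saturated_N: "aleph0_saturated L N"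
    and wf_gset: "wf_fm L (fst (gset G))" and wf_gmult: "wf_fm L (fst (gmult G))"
    and r0: "r0 \<in> fin_partial_elem L M N" and params: "Id_on (grp_params G) \<subseteq> r0"
begin

definition exts :: "('a \<times> 'a) set set" where
  "exts = {r \<in> fin_partial_elem L M N. r0 \<subseteq> r}"

definition point_map :: "('a \<times> 'a) set \<Rightarrow> ('a list \<times> 'a list) set" where
  "point_map r = {(xs, ys). xs \<in> points G M \<and> matched r xs ys}"

lemma extend_pair:
  assumes "r \<in> exts"
  shows "saturated_pair L M N G r"
proof (rule saturated_pair.intro[OF saturated_M saturated_N wf_gset wf_gmult])
  show "r \<in> fin_partial_elem L M N" "Id_on (grp_params G) \<subseteq> r"
    using assms params by (auto simp: exts_def)
qed

lemma swap: "saturated_pair L N M G (r0\<inverse>)"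
proof (rule saturated_pair.intro[OF saturated_N saturated_M wf_gset wf_gmult])
  show "r0\<inverse> \<in> fin_partial_elem L N M" by (rule fin_partial_elem_converse[OF r0])
  show "Id_on (grp_params G) \<subseteq> r0\<inverse>" using params by blast
qed

lemma points_iff:
  assumes "r \<in> exts" "matched r xs ys"
  shows "xs \<in> points G M \<longleftrightarrow> ys \<in> points G N"
proof -
  obtain p c where pc: "gset G = (p, c)" by fastforce
  have "(c i, c i) \<in> r" if "i \<in> fv p" "gdim G \<le> i" for i
    using params assms(1) that pc unfolding exts_def grp_params_def by auto
  moreover have "r \<in> fin_partial_elem L M N" using assms(1) by (simp add: exts_def)
  moreover have "wf_fm L p" using wf_gset pc by simp
  ultimately show ?thesis
    unfolding points_def pc by (intro fin_partial_elem_solutions_iff[OF _ _ _ assms(2)]) auto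
qed

lemma gmult_iff:
  assumes "r \<in> exts" "matched r x x'" "matched r y y'" "matched r z z'"
  shows "x @ y @ z \<in> solutions M (3 * gdim G) (gmult G) \<longleftrightarrow>
    x' @ y' @ z' \<in> solutions N (3 * gdim G) (gmult G)"
proof -
  obtain p c where pc: "gmult G = (p, c)" by fastforce
  have "(c i, c i) \<in> r" if "i \<in> fv p" "3 * gdim G \<le> i" for i
    using params assms(1) that pc unfolding exts_def grp_params_def by auto
  moreover have "r \<in> fin_partial_elem L M N" using assms(1) by (simp add: exts_def)
  moreover have "wf_fm L p" using wf_gmult pc by simp
  moreover have "matched r (x @ y @ z) (x' @ y' @ z')"
    using assms(2-4) by (intro list_all2_appendI)
  ultimately show ?thesis unfolding pc by (intro fin_partial_elem_solutions_iff) auto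
qed

lemma forth_points:
  assumes "r \<in> exts" "xs \<in> points G M"
  obtains r' ys where "r' \<in> exts" "r \<subseteq> r'" "matched r' xs ys" "ys \<in> points G N"
proof -
  obtain r' ys where "r' \<in> fin_partial_elem L M N" "r \<subseteq> r'" "matched r' xs ys"
    using fin_partial_elem_forth_tuple[OF saturated_N _ points_subset[OF assms(2)]] assms(1)
    unfolding exts_def by blast
  then show thesis using assms points_iff[of r' xs ys] that[of r' ys] unfolding exts_def by blast
qed

lemma back_points:
  assumes "r \<in> exts" "ys \<in> points G N"
  obtains r' xs where "r' \<in> exts" "r \<subseteq> r'" "matched r' xs ys" "xs \<in> points G M"
proof -
  obtain r' xs where "r' \<in> fin_partial_elem L M N" "r \<subseteq> r'" "matched r' xs ys"
    using fin_partial_elem_back_tuple[OF saturated_M _ points_subset[OF assms(2)]] assms(1)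
    unfolding exts_def by blast
  then show thesis using assms points_iff[of r' xs ys] that[of r' xs] unfolding exts_def by blast
qed

lemma r0_ext: "r0 \<in> exts"
  using r0 by (simp add: exts_def)

lemma matched_eq_iff:
  assumes "r \<in> exts" "matched r xs ys" "matched r xs' ys'"
  shows "xs = xs' \<longleftrightarrow> ys = ys'"
proof (rule fin_partial_elem_matched_eq_iff[OF _ assms(2,3)])
  show "r \<in> fin_partial_elem L M N" using assms(1) by (simp add: exts_def)
qed

text \<open>That the formula defines a function on \<open>G(N)\<close> must be known before the system can be seen as one
  between \<open>group_of G M\<close> and \<open>group_of G N\<close>, whose multiplication is given by a definite description.
  Hence this first-order fact is transferred by hand, on the level of the defining formula.\<close>

lemma mult_functional_forth:
  assumes "mult_functional G M"
  shows "mult_functional G N"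
  unfolding mult_functional_def
proof (intro ballI)
  fix x' y' assume "x' \<in> points G N" "y' \<in> points G N"
  then obtain r x where r: "r \<in> exts" "matched r x x'" "x \<in> points G M"
    using back_points[OF r0_ext] by metis
  obtain s y where s: "s \<in> exts" "r \<subseteq> s" "matched s y y'" "y \<in> points G M"
    using back_points[OF r(1) \<open>y' \<in> points G N\<close>] .
  have ex1: "\<exists>!z. z \<in> points G M \<and> x @ y @ z \<in> solutions M (3 * gdim G) (gmult G)"
    using assms r(3) s(4) by (simp add: mult_functional_def)
  then obtain z where z: "z \<in> points G M" "x @ y @ z \<in> solutions M (3 * gdim G) (gmult G)" by blast
  obtain u z' where u: "u \<in> exts" "s \<subseteq> u" "matched u z z'" "z' \<in> points G N"
    using forth_points[OF s(1) z(1)] .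
  have xy: "matched u x x'" "matched u y y'"
    using matched_mono[OF r(2)] matched_mono[OF s(3)] s(2) u(2) by auto
  show "\<exists>!z'. z' \<in> points G N \<and> x' @ y' @ z' \<in> solutions N (3 * gdim G) (gmult G)"
  proof (intro ex1I[of _ z'] conjI)
    show "z' \<in> points G N" by fact
    show "x' @ y' @ z' \<in> solutions N (3 * gdim G) (gmult G)" using gmult_iff[OF u(1) xy u(3)] z by simp
    fix w' assume w': "w' \<in> points G N \<and> x' @ y' @ w' \<in> solutions N (3 * gdim G) (gmult G)"
    then obtain v w where v: "v \<in> exts" "u \<subseteq> v" "matched v w w'" "w \<in> points G M"
      using back_points[OF u(1)] by metis
    have m: "matched v x x'" "matched v y y'" "matched v z z'"
      using xy u(3) matched_mono v(2) by auto
    have "x @ y @ w \<in> solutions M (3 * gdim G) (gmult G)"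
      using gmult_iff[OF v(1) m(1,2) v(3)] w' by simp
    then have "w = z" using ex1 z v(4) by auto
    then show "w' = z'" using matched_eq_iff[OF v(1,3) m(3)] by simp
  qed
qed

lemma back_and_forth_group_of:
  assumes "mult_functional G M"
  shows "back_and_forth (group_of G M) (group_of G N) (point_map ` exts)"
proof (rule back_and_forth.intro)
  show "point_map ` exts \<noteq> {}" using r0_ext by auto
next
  fix R assume "R \<in> point_map ` exts"
  then obtain r where r: "r \<in> exts" "R = point_map r" by blast
  then show "R \<subseteq> carrier (group_of G M) \<times> carrier (group_of G N)"
    using points_iff[OF r(1)] unfolding r(2) by (auto simp: point_map_def carrier_group_of)
next
  fix R x x' y y' assume "R \<in> point_map ` exts" "(x, x') \<in> R" "(y, y') \<in> R"
  then obtain r where "r \<in> exts" "matched r x x'" "matched r y y'" by (auto simp: point_map_def)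
  then show "x = y \<longleftrightarrow> x' = y'" by (rule matched_eq_iff)
next
  fix R x x' y y' z z' assume "R \<in> point_map ` exts" "(x, x') \<in> R" "(y, y') \<in> R" "(z, z') \<in> R"
  then obtain r where r: "r \<in> exts"
    and mem: "x \<in> points G M" "y \<in> points G M" "z \<in> points G M"
    and m: "matched r x x'" "matched r y y'" "matched r z z'" by (auto simp: point_map_def)
  have "x' \<in> points G N" "y' \<in> points G N" "z' \<in> points G N"
    using mem m[THEN points_iff[OF r]] by auto
  then show "x \<otimes>\<^bsub>group_of G M\<^esub> y = z \<longleftrightarrow> x' \<otimes>\<^bsub>group_of G N\<^esub> y' = z'"
    using mem mult_functional_forth[OF assms]
    by (simp add: mult_group_of grp_mult_eq_iff assms gmult_iff[OF r m])
next
  fix R x assume "R \<in> point_map ` exts" and "x \<in> carrier (group_of G M)"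
  then obtain r where r: "r \<in> exts" "R = point_map r" and x: "x \<in> points G M"
    by (auto simp: carrier_group_of)
  obtain r' x' where r': "r' \<in> exts" "r \<subseteq> r'" "matched r' x x'" using forth_points[OF r(1) x] .
  have "R \<subseteq> point_map r'" using matched_mono[OF _ r'(2)] by (auto simp: r point_map_def)
  moreover have "(x, x') \<in> point_map r'" using r'(3) x by (simp add: point_map_def)
  ultimately show "\<exists>R'\<in>point_map ` exts. R \<subseteq> R' \<and> (\<exists>x'. (x, x') \<in> R')" using r'(1) by blast
next
  fix R x' assume "R \<in> point_map ` exts" and "x' \<in> carrier (group_of G N)"
  then obtain r where r: "r \<in> exts" "R = point_map r" and x': "x' \<in> points G N"
    by (auto simp: carrier_group_of)
  obtain r' x where r': "r' \<in> exts" "r \<subseteq> r'" "matched r' x x'" "x \<in> points G M"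
    using back_points[OF r(1) x'] .
  have "R \<subseteq> point_map r'" using matched_mono[OF _ r'(2)] by (auto simp: r point_map_def)
  moreover have "(x, x') \<in> point_map r'" using r'(3,4) by (simp add: point_map_def)
  ultimately show "\<exists>R'\<in>point_map ` exts. R \<subseteq> R' \<and> (\<exists>x. (x, x') \<in> R')" using r'(1) by blast
next
  fix x y assume "x \<in> carrier (group_of G M)" "y \<in> carrier (group_of G M)"
  then show "x \<otimes>\<^bsub>group_of G M\<^esub> y \<in> carrier (group_of G M)"
    using grp_mult_closed[OF assms] by (simp add: carrier_group_of mult_group_of)
next
  fix x y assume "x \<in> carrier (group_of G N)" "y \<in> carrier (group_of G N)"
  then show "x \<otimes>\<^bsub>group_of G N\<^esub> y \<in> carrier (group_of G N)"
    using grp_mult_closed[OF mult_functional_forth[OF assms]]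
    by (simp add: carrier_group_of mult_group_of)
qed

text \<open>The transferred group axioms yield some neutral element \<open>e\<close>; it is unique, hence equal to the unit
  of \<open>group_of G N\<close>, which is a definite description.\<close>

lemma definable_group_forth:
  assumes "definable_group L M G"
  shows "definable_group L N G"
proof -
  have fun_M: "mult_functional G M" and grp: "group (group_of G M)"
    using assms by (auto simp: definable_group_iff)
  interpret bf: back_and_forth "group_of G M" "group_of G N" "point_map ` exts"
    by (rule back_and_forth_group_of[OF fun_M])
  let ?H = "group_of G N"
  obtain e where e: "e \<in> carrier ?H"
    "\<forall>x\<in>carrier ?H. e \<otimes>\<^bsub>?H\<^esub> x = x \<and> x \<otimes>\<^bsub>?H\<^esub> e = x \<and> (\<exists>y\<in>carrier ?H. y \<otimes>\<^bsub>?H\<^esub> x = e)"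
    using bf.group_transfer(2)[OF grp] by blast
  have one: "\<one>\<^bsub>?H\<^esub> = e"
  proof -
    have "\<one>\<^bsub>?H\<^esub> = (THE e. e \<in> carrier ?H \<and> (\<forall>x\<in>carrier ?H. e \<otimes>\<^bsub>?H\<^esub> x = x \<and> x \<otimes>\<^bsub>?H\<^esub> e = x))"
      by (simp add: group_of_def)
    also have "\<dots> = e"
    proof (rule the_equality)
      show "e \<in> carrier ?H \<and> (\<forall>x\<in>carrier ?H. e \<otimes>\<^bsub>?H\<^esub> x = x \<and> x \<otimes>\<^bsub>?H\<^esub> e = x)" using e by blast
      show "d = e" if "d \<in> carrier ?H \<and> (\<forall>x\<in>carrier ?H. d \<otimes>\<^bsub>?H\<^esub> x = x \<and> x \<otimes>\<^bsub>?H\<^esub> d = x)" for d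
        using that e by metis
    qed
    finally show ?thesis .
  qed
  have "group ?H"
  proof (rule groupI)
    show "\<one>\<^bsub>?H\<^esub> \<in> carrier ?H" using e(1) one by simp
    show "x \<otimes>\<^bsub>?H\<^esub> y \<in> carrier ?H" if "x \<in> carrier ?H" "y \<in> carrier ?H" for x y
      using bf.closed_H that .
    show "x \<otimes>\<^bsub>?H\<^esub> y \<otimes>\<^bsub>?H\<^esub> z = x \<otimes>\<^bsub>?H\<^esub> (y \<otimes>\<^bsub>?H\<^esub> z)"
      if "x \<in> carrier ?H" "y \<in> carrier ?H" "z \<in> carrier ?H" for x y z
      using bf.group_transfer(1)[OF grp] that by blast
    show "\<one>\<^bsub>?H\<^esub> \<otimes>\<^bsub>?H\<^esub> x = x" if "x \<in> carrier ?H" for x using e(2) that one by simp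
    show "\<exists>y\<in>carrier ?H. y \<otimes>\<^bsub>?H\<^esub> x = \<one>\<^bsub>?H\<^esub>" if "x \<in> carrier ?H" for x using e(2) that one by simp
  qed
  moreover have "grp_params G \<subseteq> universe N" using params r0 by (auto simp: fin_partial_elem_def)
  ultimately show ?thesis
    using mult_functional_forth[OF fun_M] wf_gset wf_gmult by (simp add: definable_group_iff)
qed

lemma transfer_definable_set:
  assumes "definable_group L M G" "wf_fm L p"
    and "\<And>i. i \<in> fv p \<Longrightarrow> gdim G \<le> i \<Longrightarrow> (c i, c' i) \<in> r0"
    and "solutions N (gdim G) (p, c') \<subseteq> points G N"
  shows "solutions M (gdim G) (p, c) \<subseteq> points G M"
    and "weakly_generic (group_of G M) (solutions M (gdim G) (p, c)) \<longleftrightarrow>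
      weakly_generic (group_of G N) (solutions N (gdim G) (p, c'))"
    and "J_set (group_of G M) (solutions M (gdim G) (p, c)) \<longleftrightarrow>
      J_set (group_of G N) (solutions N (gdim G) (p, c'))"
proof -
  have iff: "xs \<in> solutions M (gdim G) (p, c) \<longleftrightarrow> ys \<in> solutions N (gdim G) (p, c')"
    if "r \<in> exts" "matched r xs ys" for r xs ys
    using that assms(2,3) by (intro fin_partial_elem_solutions_iff[of r L M N]) (auto simp: exts_def)
  show sub: "solutions M (gdim G) (p, c) \<subseteq> points G M"
  proof
    fix xs assume xs: "xs \<in> solutions M (gdim G) (p, c)"
    then have "set xs \<subseteq> universe M" by (auto simp: solutions_def tuples_def)
    from fin_partial_elem_forth_tuple[OF saturated_N r0 this]
    obtain r ys where r: "r \<in> exts" "matched r xs ys" by (auto simp: exts_def)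
    then show "xs \<in> points G M" using xs iff points_iff assms(4) by blast
  qed
  have fun_M: "mult_functional G M" and grp: "group (group_of G M)"
    using assms by (auto simp: definable_group_iff)
  have "back_and_forth_groups (group_of G M) (group_of G N) (point_map ` exts)
    (solutions M (gdim G) (p, c)) (solutions N (gdim G) (p, c'))"
  proof (intro back_and_forth_groups.intro back_and_forth_groups_axioms.intro
      back_and_forth_group_of[OF fun_M] grp)
    show "x \<in> solutions M (gdim G) (p, c) \<longleftrightarrow> y \<in> solutions N (gdim G) (p, c')"
      if "R \<in> point_map ` exts" "(x, y) \<in> R" for R x y
      using that iff by (auto simp: point_map_def)
  qed (use definable_group_forth[OF assms(1)] sub assms(4) in
      \<open>simp_all add: definable_group_iff carrier_group_of\<close>)
  then interpret back_and_forth_groups "group_of G M" "group_of G N" "point_map ` exts"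
    "solutions M (gdim G) (p, c)" "solutions N (gdim G) (p, c')" .
  show "weakly_generic (group_of G M) (solutions M (gdim G) (p, c)) \<longleftrightarrow>
      weakly_generic (group_of G N) (solutions N (gdim G) (p, c'))"
    by (rule weakly_generic_transfer)
  show "J_set (group_of G M) (solutions M (gdim G) (p, c)) \<longleftrightarrow>
      J_set (group_of G N) (solutions N (gdim G) (p, c'))"
    by (rule J_set_transfer)
qed

text \<open>The parameters of \<open>X\<close> need not lie in \<open>M\<close>. The back property replaces them by elements of \<open>M\<close> with
  the same type over the parameters of \<open>G\<close>.\<close>

lemma J_set_iff_weakly_generic_forth:
  assumes "definable_group L M G"
    and M: "\<And>X. X \<subseteq> points G M \<Longrightarrow> definable L M (gdim G) X \<Longrightarrow>
      J_set (group_of G M) X \<longleftrightarrow> weakly_generic (group_of G M) X"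
    and X: "X \<subseteq> points G N" "definable L N (gdim G) X"
  shows "J_set (group_of G N) X \<longleftrightarrow> weakly_generic (group_of G N) X"
proof -
  obtain p c' where p: "wf_fm L p" and c': "\<And>i. i \<in> fv p \<Longrightarrow> gdim G \<le> i \<Longrightarrow> c' i \<in> universe N"
    and X_eq: "X = solutions N (gdim G) (p, c')"
    using X(2) by (auto simp: definable_def pfms_over_def)
  define A where "A = c' ` {i \<in> fv p. gdim G \<le> i}"
  have "finite A" by (simp add: A_def finite_fv)
  then obtain ds where ds: "set ds = A" using finite_list by blast
  then have "set ds \<subseteq> universe N" using c' by (auto simp: A_def)
  from fin_partial_elem_back_tuple[OF saturated_M r0 this]
  obtain r cs where r: "r \<in> exts" "matched r cs ds" by (auto simp: exts_def)
  have "\<exists>x. (x, c' i) \<in> r" if "i \<in> fv p" "gdim G \<le> i" for i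
  proof -
    have "c' i \<in> set ds" using that ds by (auto simp: A_def)
    then show ?thesis using r(2) unfolding in_set_conv_nth list_all2_conv_all_nth by metis
  qed
  then obtain c where c: "\<And>i. i \<in> fv p \<Longrightarrow> gdim G \<le> i \<Longrightarrow> (c i, c' i) \<in> r" by metis
  interpret ext: saturated_pair L M N G r by (rule extend_pair[OF r(1)])
  note tr = ext.transfer_definable_set[OF assms(1) p c X(1)[unfolded X_eq]]
  have "c i \<in> universe M" if "i \<in> fv p" "gdim G \<le> i" for i
    using c[OF that] r(1) by (auto simp: exts_def fin_partial_elem_def)
  then have "definable L M (gdim G) (solutions M (gdim G) (p, c))"
    using p by (auto simp: definable_def pfms_over_def)
  then show ?thesis using M tr by (simp add: X_eq)
qed

end

theorem proposition2p7:
  fixes L :: "('f, 'r) lang"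
    and M N :: "('a, 'f, 'r) struct"
    and G :: "('a, 'f, 'r) grp_fms"
  assumes "elementary_substructure L M N"
    and "aleph0_saturated L M"
    and "aleph0_saturated L N"
    and "definable_group L M G"
  shows "{X. X \<subseteq> points G M \<and> definable L M (gdim G) X \<and> J_set (group_of G M) X}
           = {X. X \<subseteq> points G M \<and> definable L M (gdim G) X \<and> weakly_generic (group_of G M) X}
     \<longleftrightarrow>
         {X. X \<subseteq> points G N \<and> definable L N (gdim G) X \<and> J_set (group_of G N) X}
           = {X. X \<subseteq> points G N \<and> definable L N (gdim G) X \<and> weakly_generic (group_of G N) X}"
proof -
  have M: "grp_params G \<subseteq> universe M" "wf_fm L (fst (gset G))" "wf_fm L (fst (gmult G))"
    using assms(4) by (auto simp: definable_group_iff)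
  interpret MN: saturated_pair L M N G "Id_on (grp_params G)"
    using elementary_substructure_Id_on[OF assms(1) finite_grp_params M(1)] assms(2,3) M
    by unfold_locales auto
  interpret NM: saturated_pair L N M G "(Id_on (grp_params G))\<inverse>" by (rule MN.swap)
  have N: "definable_group L N G" by (rule MN.definable_group_forth[OF assms(4)])
  have set_eq_iff: "{X. X \<subseteq> points G K \<and> definable L K (gdim G) X \<and> J_set (group_of G K) X}
           = {X. X \<subseteq> points G K \<and> definable L K (gdim G) X \<and> weakly_generic (group_of G K) X} \<longleftrightarrow>
      (\<forall>X. X \<subseteq> points G K \<longrightarrow> definable L K (gdim G) X \<longrightarrow>
        (J_set (group_of G K) X \<longleftrightarrow> weakly_generic (group_of G K) X))" for K :: "('a, 'f, 'r) struct"
    by blast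
  show ?thesis unfolding set_eq_iff
    using MN.J_set_iff_weakly_generic_forth[OF assms(4)] NM.J_set_iff_weakly_generic_forth[OF N]
    by blast
qed

end
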